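(* Consider the problem $\min_{x\in\mathcal{X}} f(x_1,\ldots,x_m)$, where $\mathcal{X}=\mathcal{X}_1\times\cdots\times\mathcal{X}_m$ and each $\mathcal{X}_i\subseteq\mathbb{R}^{n_i}$ is a closed convex set. For each $i=1,\ldots,m$ let $u_i(\cdot\,;\cdot)$ be a real-valued function of $(y_i,x)\in\mathcal{X}_i\times\mathcal{X}$ such that: (a) $u_i(x_i;x)=f(x)$ for all $x\in\mathcal{X}$ and all $i$; (b) $u_i(y_i;x)\ge f(x_{<i},y_i,x_{>i})$ for all $y_i\in\mathcal{X}_i$, all $x\in\mathcal{X}$ and all $i$; (c) $u_i'(y_i;x,d_i)\big|_{y_i=x_i}=f'(x;d)$ for all $x\in\mathcal{X}$, all $i$, and all $d=(0,\ldots,0,d_i,0,\ldots,0)$ (with $d_i$ in the $i$-th block) such that $x_i+d_i\in\mathcal{X}_i$; (d) $u_i(y_i;x)$ is continuous in $(y_i,x)$, for all $i$. Assume furthermore that $f$ is regular and bounded below on $\mathcal{X}$. Let $\{x^k\}_{k\ge0}$ be the sequence generated by the PR-BSUM algorithm (defined in the context) from an arbitrary $x^0\in\mathcal{X}$. Then, with probability one, every limit point of $\{x^k\}$ is a stationary point of the problem $\min_{x\in\mathcal{X}}f(x)$.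
   Context: Notation: $x=(x_1,\ldots,x_m)$ with blocks $x_i\in\mathbb{R}^{n_i}$; $x_{<i}$ and $x_{>i}$ denote the blocks of $x$ with index less than $i$, respectively larger than $i$. $f'(x;d)=\liminf_{\lambda\downarrow0}\frac{f(x+\lambda d)-f(x)}{\lambda}$ is the directional derivative of $f$ at $x$ along $d$, and $u_i'(y_i;x,d_i)$ is the directional derivative of $u_i(\cdot\,;x)$ at $y_i$ along $d_i$ (with $x$ held fixed). Stationary point: $x\in\mathcal{X}$ is a stationary point of $\min_{x\in\mathcal{X}}f(x)$ if $f'(x;d)\ge0$ for all $d$ with $x+d\in\mathcal{X}$. Regular: $f$ is regular at $x\in\mathcal X$ if, for every $d=(d_1,\ldots,d_m)$ with $x+d\in\mathcal{X}$ such that $f'(x;(0,\ldots,0,d_i,0,\ldots,0))\ge0$ for every $i$, one has $f'(x;d)\ge0$; $f$ is regular if it is regular at every $x\in\mathcal{X}$. PR-BSUM (permutation-based randomized block successive upper-bound minimization) algorithm: start from $x^0\in\mathcal{X}$. At iteration $k=0,1,2,\ldots$: set $y=x^k$; draw a permutation of $\{1,\ldots,m\}$ uniformly at random among all $m!$ permutations, independently of all previous draws; going through the indices $i$ in the order given by this permutation, replace the $i$-th block $y_i$ of the current $y$ by an arbitrary element of $\arg\min_{z_i\in\mathcal{X}_i}u_i(z_i;y)$ (where $y$ is the current vector, including blocks already updated in this iteration); after all $m$ blocks have been updated, set $x^{k+1}=y$. It is understood that these argmin sets are nonempty, so that the algorithm is well defined, and that the element chosen may depend only on $x^0$ and on the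 permutations drawn so far. *)

theory Defs
  imports "HOL-Probability.Probability"
begin

text \<open>
  A block structure on the space \<open>real ^ 'n\<close> is a map \<open>blk\<close> sending every coordinate to the
  index (in \<open>{1..m}\<close>) of the block it belongs to; the \<open>i\<close>-th block then has
  \<open>card {j. blk j = i}\<close> coordinates, so the dimensions of the blocks may differ.  The factor
  belonging to block \<open>i\<close> is identified with the subspace \<open>block_space blk i\<close> of \<open>real ^ 'n\<close> of
  vectors vanishing outside block \<open>i\<close>; thus a block vector \<open>d\<^sub>i\<close> and its zero-padded version
  \<open>(0, \<dots>, 0, d\<^sub>i, 0, \<dots>, 0)\<close> are the same object.
\<close>

definition block_space :: "('n::finite \<Rightarrow> nat) \<Rightarrow> nat \<Rightarrow> (real ^ 'n) set" where
  "block_space blk i = {v. \<forall>j. blk j \<noteq> i \<longrightarrow> v $ j = 0}"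

definition block :: "('n::finite \<Rightarrow> nat) \<Rightarrow> nat \<Rightarrow> real ^ 'n \<Rightarrow> real ^ 'n" where
  "block blk i x = (\<chi> j. if blk j = i then x $ j else 0)"

text \<open>The vector \<open>(x\<^bsub><i\<^esub>, z, x\<^bsub>>i\<^esub>)\<close>.\<close>

definition block_upd ::
  "('n::finite \<Rightarrow> nat) \<Rightarrow> nat \<Rightarrow> real ^ 'n \<Rightarrow> real ^ 'n \<Rightarrow> real ^ 'n" where
  "block_upd blk i x z = (\<chi> j. if blk j = i then z $ j else x $ j)"

definition block_prod ::
  "('n::finite \<Rightarrow> nat) \<Rightarrow> nat \<Rightarrow> (nat \<Rightarrow> (real ^ 'n) set) \<Rightarrow> (real ^ 'n) set" where
  "block_prod blk m X = {x. \<forall>i\<in>{1..m}. block blk i x \<in> X i}"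

text \<open>
  The lower limit is taken in the extended reals.  When \<open>x\<close> and \<open>x + d\<close> lie in a convex set,
  only values of \<open>f\<close> on that set matter.
\<close>

definition dir_deriv :: "('a::real_vector \<Rightarrow> real) \<Rightarrow> 'a \<Rightarrow> 'a \<Rightarrow> ereal" where
  "dir_deriv f x d =
     Liminf (at_right 0) (\<lambda>t::real. ereal ((f (x + t *\<^sub>R d) - f x) / t))"

definition stationary_point ::
  "('a::real_vector) set \<Rightarrow> ('a \<Rightarrow> real) \<Rightarrow> 'a \<Rightarrow> bool" where
  "stationary_point S f x \<longleftrightarrow> x \<in> S \<and> (\<forall>d. x + d \<in> S \<longrightarrow> 0 \<le> dir_deriv f x d)"

definition regular_at ::
  "('n::finite \<Rightarrow> nat) \<Rightarrow> nat \<Rightarrow> (real ^ 'n) set \<Rightarrow> (real ^ 'n \<Rightarrow> real) \<Rightarrow> real ^ 'n \<Rightarrow> bool" where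
  "regular_at blk m S f x \<longleftrightarrow>
     (\<forall>d. x + d \<in> S \<and> (\<forall>i\<in>{1..m}. 0 \<le> dir_deriv f x (block blk i d))
        \<longrightarrow> 0 \<le> dir_deriv f x d)"

definition regular_on ::
  "('n::finite \<Rightarrow> nat) \<Rightarrow> nat \<Rightarrow> (real ^ 'n) set \<Rightarrow> (real ^ 'n \<Rightarrow> real) \<Rightarrow> bool" where
  "regular_on blk m S f \<longleftrightarrow> (\<forall>x\<in>S. regular_at blk m S f x)"

definition seq_limit_point :: "(nat \<Rightarrow> 'a::topological_space) \<Rightarrow> 'a \<Rightarrow> bool" where
  "seq_limit_point x z \<longleftrightarrow> (\<exists>r. strict_mono r \<and> (x \<circ> r) \<longlonglongrightarrow> z)"

text \<open>
  A permutation of \<open>{1..m}\<close> is represented by the list of its values, i.e. by the order in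
  which the blocks are visited.
\<close>

definition iid_uniform_permutations ::
  "'w measure \<Rightarrow> nat \<Rightarrow> (nat \<Rightarrow> 'w \<Rightarrow> nat list) \<Rightarrow> bool" where
  "iid_uniform_permutations M m \<sigma> \<longleftrightarrow>
     prob_space M \<and>
     prob_space.indep_vars M (\<lambda>_. count_space (permutations_of_set {1..m})) \<sigma> UNIV \<and>
     (\<forall>k. distr M (count_space (permutations_of_set {1..m})) (\<sigma> k)
            = uniform_count_measure (permutations_of_set {1..m}))"

text \<open>
  \<open>y k j\<close> is the current vector of iteration \<open>k\<close> after its first \<open>j\<close> block updates, and
  \<open>\<sigma> k\<close> is the permutation drawn in iteration \<open>k\<close>.  The minimizers are arbitrary, except
  that (last conjunct) the vectors produced in iteration \<open>k\<close> are determined by \<open>x0\<close> and the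
  permutations drawn in iterations \<open>0, \<dots>, k\<close>.
\<close>

definition pr_bsum ::
  "'w measure \<Rightarrow> ('n::finite \<Rightarrow> nat) \<Rightarrow> nat \<Rightarrow> (nat \<Rightarrow> (real ^ 'n) set)
     \<Rightarrow> (nat \<Rightarrow> real ^ 'n \<Rightarrow> real ^ 'n \<Rightarrow> real) \<Rightarrow> real ^ 'n
     \<Rightarrow> (nat \<Rightarrow> 'w \<Rightarrow> nat list) \<Rightarrow> (nat \<Rightarrow> nat \<Rightarrow> 'w \<Rightarrow> real ^ 'n)
     \<Rightarrow> (nat \<Rightarrow> 'w \<Rightarrow> real ^ 'n) \<Rightarrow> bool" where
  "pr_bsum M blk m X u x0 \<sigma> y x \<longleftrightarrow>
     iid_uniform_permutations M m \<sigma> \<and>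
     (\<forall>\<omega>\<in>space M.
        x 0 \<omega> = x0 \<and>
        (\<forall>k. y k 0 \<omega> = x k \<omega> \<and>
             (\<forall>j<m. \<exists>z.
                is_arg_min (\<lambda>z. u (\<sigma> k \<omega> ! j) z (y k j \<omega>)) (\<lambda>z. z \<in> X (\<sigma> k \<omega> ! j)) z \<and>
                y k (Suc j) \<omega> = block_upd blk (\<sigma> k \<omega> ! j) (y k j \<omega>) z) \<and>
             x (Suc k) \<omega> = y k m \<omega>)) \<and>
     (\<forall>k. \<forall>\<omega>\<in>space M. \<forall>\<omega>'\<in>space M.
        (\<forall>l\<le>k. \<sigma> l \<omega> = \<sigma> l \<omega>') \<longrightarrow> (\<forall>j\<le>m. y k j \<omega> = y k j \<omega>'))"

end

theory Submission
  imports Defs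
begin

text \<open>
  The value \<open>f\<close> decreases along every block update, because the surrogate \<open>u i\<close> majorizes \<open>f\<close> and
  touches it at the current vector.  How much is gained by updating block \<open>i\<close> at \<open>v\<close> is at least the
  optimality gap \<open>gap i v = f v - (INF w\<in>X i. u i w v) \<ge> 0\<close>.  If block \<open>i\<close> happens to come first in
  iteration \<open>k\<close>, the whole iteration therefore gains at least \<open>gap i\<close> at the vector with which the
  iteration starts.  That vector depends only on earlier permutations, hence is independent of
  the event that block \<open>i\<close> comes first, and this event has the same positive probability \<open>p\<close> in all
  iterations.  So the expected gain is at least \<open>p\<close> times the expected gap, and as \<open>f\<close> is bounded
  below, the expected gaps form a convergent series (\<open>sum_expected_gap_le\<close>).
  Consequently all gaps tend to \<open>0\<close> along almost every trajectory
  (\<open>AE_LIMSEQ_zero_of_expectation_sums\<close>).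

  The rest is deterministic (\<open>stationary_of_gaps_vanish\<close>).  By continuity of \<open>u i\<close>, vanishing gaps
  force each block of a limit point \<open>z\<close> to minimize \<open>u i\<close> at \<open>z\<close>; the first-order condition for this
  minimum transfers to \<open>f\<close>, since \<open>u i\<close> and \<open>f\<close> have the same directional derivatives there, and
  regularity assembles the blockwise conditions into stationarity.

  Only infima of the surrogates are used for blocks that are not first.  This matters as the
  algorithm guarantees a minimizer of \<open>u i\<close> only at the vectors where block \<open>i\<close> is actually updated.
\<close>

section \<open>Functions of the past of an independent sequence\<close>

text \<open>
  A quantity determined by finitely many draws from a finite set takes finitely many values and is
  measurable whatever the function that computes it; this is why arbitrary choices of minimizers
  cause no measurability problem.
\<close>

lemma (in prob_space) finite_history_factor:
  fixes \<sigma> :: "nat \<Rightarrow> 'a \<Rightarrow> 'b" and U :: "'a \<Rightarrow> real"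
  assumes fin: "finite S" and meas: "\<And>l. \<sigma> l \<in> measurable M (count_space S)"
    and dep: "\<And>\<omega> \<omega>'. \<omega> \<in> space M \<Longrightarrow> \<omega>' \<in> space M \<Longrightarrow> (\<And>l. l < k \<Longrightarrow> \<sigma> l \<omega> = \<sigma> l \<omega>') \<Longrightarrow> U \<omega> = U \<omega>'"
  obtains G where "G \<in> borel_measurable (PiM {..<k} (\<lambda>_. count_space S))"
    and "\<And>\<omega>. \<omega> \<in> space M \<Longrightarrow> U \<omega> = G (restrict (\<lambda>l. \<sigma> l \<omega>) {..<k})"
    and "integrable M U"
proof -
  define h where "h \<omega> = restrict (\<lambda>l. \<sigma> l \<omega>) {..<k}" for \<omega>
  define G where "G c = U (SOME \<omega>. \<omega> \<in> space M \<and> h \<omega> = c)" for c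
  have PiM_eq: "PiM {..<k} (\<lambda>_. count_space S) = count_space (PiE {..<k} (\<lambda>_. S))"
    using fin by (intro count_space_PiM_finite) (auto intro: countable_finite)
  have UG: "U \<omega> = G (h \<omega>)" if "\<omega> \<in> space M" for \<omega>
  proof -
    define \<omega>' where "\<omega>' = (SOME \<omega>'. \<omega>' \<in> space M \<and> h \<omega>' = h \<omega>)"
    have "\<omega>' \<in> space M \<and> h \<omega>' = h \<omega>"
      unfolding \<omega>'_def by (rule someI[of _ \<omega>]) (use that in simp)
    then have "U \<omega> = U \<omega>'"
      using that by (intro dep) (auto simp: h_def restrict_def fun_eq_iff split: if_splits)
    then show ?thesis
      by (simp add: G_def \<omega>'_def)
  qed
  have G_meas: "G \<in> borel_measurable (PiM {..<k} (\<lambda>_. count_space S))"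
    unfolding PiM_eq by simp
  have h_meas: "h \<in> measurable M (PiM {..<k} (\<lambda>_. count_space S))"
    unfolding h_def using meas by (intro measurable_restrict) auto
  have U_meas: "U \<in> borel_measurable M"
    using measurable_comp[OF h_meas G_meas] UG by (subst measurable_cong[where g = "G \<circ> h"]) auto
  have "U ` space M \<subseteq> G ` PiE {..<k} (\<lambda>_. S)"
    using UG measurable_space[OF h_meas] by (auto simp: PiM_eq)
  moreover have "finite (G ` PiE {..<k} (\<lambda>_. S))"
    using fin by (intro finite_imageI finite_PiE) auto
  ultimately have "bounded (U ` space M)"
    by (meson finite_imp_bounded finite_subset)
  then obtain B where "\<And>\<omega>. \<omega> \<in> space M \<Longrightarrow> norm (U \<omega>) \<le> B"
    unfolding bounded_iff by auto
  then have "integrable M U"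
    using U_meas by (intro integrable_const_bound[where B = B]) auto
  with that[OF G_meas] UG show thesis
    unfolding h_def by blast
qed

text \<open>
  The draw \<open>\<sigma> k\<close> is independent of the joint history \<open>\<sigma> 0, \<dots>, \<sigma> (k - 1)\<close>, through which \<open>U\<close>
  factors.
\<close>

lemma (in prob_space) expectation_indicator_mult_past:
  fixes \<sigma> :: "nat \<Rightarrow> 'a \<Rightarrow> 'b" and U :: "'a \<Rightarrow> real"
  assumes ind: "indep_vars (\<lambda>_. count_space S) \<sigma> UNIV" and fin: "finite S" and AS: "A \<subseteq> S"
    and dep: "\<And>\<omega> \<omega>'. \<omega> \<in> space M \<Longrightarrow> \<omega>' \<in> space M \<Longrightarrow> (\<And>l. l < k \<Longrightarrow> \<sigma> l \<omega> = \<sigma> l \<omega>') \<Longrightarrow> U \<omega> = U \<omega>'"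
  shows "integrable M (\<lambda>\<omega>. indicator A (\<sigma> k \<omega>) * U \<omega>)"
    and "expectation (\<lambda>\<omega>. indicator A (\<sigma> k \<omega>) * U \<omega>)
           = measure (distr M (count_space S) (\<sigma> k)) A * expectation U"
proof -
  have meas: "\<sigma> l \<in> measurable M (count_space S)" for l
    using ind by (auto simp: indep_vars_def)
  obtain G where G: "G \<in> borel_measurable (PiM {..<k} (\<lambda>_. count_space S))"
    and UG: "\<And>\<omega>. \<omega> \<in> space M \<Longrightarrow> U \<omega> = G (restrict (\<lambda>l. \<sigma> l \<omega>) {..<k})"
    and intU: "integrable M U"
    using finite_history_factor[of S \<sigma> k U, OF fin meas dep] by blast
  define P where "P \<omega> = G (restrict (\<lambda>l. \<sigma> l \<omega>) {..<k})" for \<omega>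
  define I :: "'a \<Rightarrow> real" where "I \<omega> = indicator A (\<sigma> k \<omega>)" for \<omega>
  have Y: "(\<lambda>c. indicator A (c k) :: real) \<in> borel_measurable (PiM {k} (\<lambda>_. count_space S))"
  proof (rule measurable_compose[where N = "count_space S"])
    show "(\<lambda>c. c k) \<in> measurable (PiM {k} (\<lambda>_. count_space S)) (count_space S)"
      by (rule measurable_component_singleton) simp
  qed simp
  have "indep_var (PiM {k} (\<lambda>_. count_space S)) (\<lambda>\<omega>. restrict (\<lambda>l. \<sigma> l \<omega>) {k})
          (PiM {..<k} (\<lambda>_. count_space S)) (\<lambda>\<omega>. restrict (\<lambda>l. \<sigma> l \<omega>) {..<k})"
    by (rule indep_var_restrict[OF ind]) auto
  from indep_var_compose[OF this Y G] have indep: "indep_var borel I borel P"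
    by (simp add: comp_def I_def[abs_def] P_def[abs_def])
  have intI: "integrable M I"
    using indep_var_rv1[OF indep] by (intro integrable_const_bound[where B = 1]) (auto simp: I_def)
  have intP: "integrable M P"
    using intU UG by (subst Bochner_Integration.integrable_cong[OF refl, where g = U]) (auto simp: P_def)
  have eI: "expectation I = measure (distr M (count_space S) (\<sigma> k)) A"
  proof -
    have "expectation I = (\<integral>s. indicator A s \<partial>distr M (count_space S) (\<sigma> k))"
      unfolding I_def using meas AS by (subst integral_distr) auto
    also have "\<dots> = measure (distr M (count_space S) (\<sigma> k)) A"
      using AS by (simp add: Int_absorb2)
    finally show ?thesis .
  qed
  have cong: "indicator A (\<sigma> k \<omega>) * U \<omega> = I \<omega> * P \<omega>" "U \<omega> = P \<omega>" if "\<omega> \<in> space M" for \<omega>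
    using UG[OF that] by (auto simp: I_def P_def)
  show "integrable M (\<lambda>\<omega>. indicator A (\<sigma> k \<omega>) * U \<omega>)"
    using indep_var_integrable[OF indep intI intP] cong
    by (subst Bochner_Integration.integrable_cong[OF refl, where g = "\<lambda>\<omega>. I \<omega> * P \<omega>"]) auto
  have "expectation (\<lambda>\<omega>. indicator A (\<sigma> k \<omega>) * U \<omega>) = expectation (\<lambda>\<omega>. I \<omega> * P \<omega>)"
    using cong by (intro Bochner_Integration.integral_cong) auto
  also have "\<dots> = expectation I * expectation P"
    by (rule indep_var_lebesgue_integral[OF indep intI intP])
  also have "expectation P = expectation U"
    using cong by (intro Bochner_Integration.integral_cong) auto
  finally show "expectation (\<lambda>\<omega>. indicator A (\<sigma> k \<omega>) * U \<omega>)
           = measure (distr M (count_space S) (\<sigma> k)) A * expectation U"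
    by (simp add: eI)
qed

text \<open>
  By monotone convergence the pointwise series has finite expectation, so it converges almost
  surely and its terms tend to \<open>0\<close>.
\<close>

lemma AE_LIMSEQ_zero_of_expectation_sums:
  fixes Z :: "nat \<Rightarrow> 'a \<Rightarrow> real"
  assumes int: "\<And>k. integrable M (Z k)"
    and nonneg: "\<And>k \<omega>. \<omega> \<in> space M \<Longrightarrow> 0 \<le> Z k \<omega>"
    and bound: "\<And>n. (\<Sum>k<n. integral\<^sup>L M (Z k)) \<le> C"
  shows "AE \<omega> in M. (\<lambda>k. Z k \<omega>) \<longlonglongrightarrow> 0"
proof -
  have e0: "0 \<le> integral\<^sup>L M (Z k)" for k
    using nonneg by (intro integral_nonneg_AE) auto
  have meas: "(\<lambda>\<omega>. ennreal (Z k \<omega>)) \<in> borel_measurable M" for k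
    using int[of k] by measurable
  have "(\<integral>\<^sup>+\<omega>. (\<Sum>k. ennreal (Z k \<omega>)) \<partial>M) = (\<Sum>k. \<integral>\<^sup>+\<omega>. ennreal (Z k \<omega>) \<partial>M)"
    using meas by (intro nn_integral_suminf)
  also have "\<dots> = (\<Sum>k. ennreal (integral\<^sup>L M (Z k)))"
    using int nonneg by (intro suminf_cong nn_integral_eq_integral) auto
  also have "\<dots> \<noteq> \<infinity>"
  proof -
    have "summable (\<lambda>k. integral\<^sup>L M (Z k))"
      using e0 bound by (intro bounded_imp_summable[where B = C]) (simp_all flip: lessThan_Suc_atMost del: sum.lessThan_Suc)
    then show ?thesis
      using e0 by (simp add: suminf_ennreal2)
  qed
  finally have "AE \<omega> in M. (\<Sum>k. ennreal (Z k \<omega>)) \<noteq> \<infinity>"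
    using meas by (intro nn_integral_PInf_AE) auto
  with AE_space show ?thesis
  proof eventually_elim
    case (elim \<omega>)
    have "summable (\<lambda>k. Z k \<omega>)"
      using elim nonneg by (intro summable_suminf_not_top) auto
    then show ?case
      by (rule summable_LIMSEQ_zero)
  qed
qed

section \<open>Optimality gaps of the block surrogates\<close>

lemma dir_deriv_nonneg_if_min:
  assumes "convex S" and "p \<in> S" and "p + d \<in> S" and min: "\<And>w. w \<in> S \<Longrightarrow> h p \<le> h w"
  shows "0 \<le> dir_deriv h p d"
  unfolding dir_deriv_def
proof (rule Liminf_bounded)
  have "eventually (\<lambda>t::real. t \<in> {0<..<1}) (at_right 0)"
    by (rule eventually_at_right_real) simp
  then show "eventually (\<lambda>t. 0 \<le> ereal ((h (p + t *\<^sub>R d) - h p) / t)) (at_right 0)"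
  proof eventually_elim
    case (elim t)
    have "(1 - t) *\<^sub>R p + t *\<^sub>R (p + d) \<in> S"
      using assms elim by (intro convexD) auto
    then have "p + t *\<^sub>R d \<in> S"
      by (simp add: algebra_simps)
    then show ?case
      using min elim by simp
  qed
qed

lemma block_block_upd_same:
  assumes "w \<in> block_space blk i"
  shows "block blk i (block_upd blk i v w) = w"
  using assms by (auto simp: block_def block_upd_def block_space_def vec_eq_iff)

lemma block_block_upd_other:
  assumes "j \<noteq> i"
  shows "block blk j (block_upd blk i v w) = block blk j v"
  using assms by (auto simp: block_def block_upd_def vec_eq_iff)

lemma block_add: "block blk i (v + w) = block blk i v + block blk i w"
  by (auto simp: block_def vec_eq_iff)

lemma block_in_block_space: "block blk i v \<in> block_space blk i"
  by (auto simp: block_def block_space_def)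

lemma continuous_on_block: "continuous_on S (block blk i)"
proof -
  have "continuous_on S (\<lambda>x. if blk j = i then x $ j else 0)" for j
    by (cases "blk j = i") (auto intro!: continuous_intros)
  then show ?thesis
    unfolding block_def by (intro continuous_on_vec_lambda)
qed

lemma closed_block_prod:
  assumes "\<And>i. i \<in> {1..m} \<Longrightarrow> closed (X i)"
  shows "closed (block_prod blk m X)"
proof -
  have "block_prod blk m X = (\<Inter>i\<in>{1..m}. block blk i -` X i)"
    by (auto simp: block_prod_def)
  moreover have "closed (block blk i -` X i)" if "i \<in> {1..m}" for i
    using assms[OF that] continuous_on_block by (intro closed_vimage)
  ultimately show ?thesis
    by (simp add: closed_INT)
qed

locale block_majorization =
  fixes blk :: "'n::finite \<Rightarrow> nat" and m :: nat
    and X :: "nat \<Rightarrow> (real ^ 'n) set"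
    and f :: "real ^ 'n \<Rightarrow> real"
    and u :: "nat \<Rightarrow> real ^ 'n \<Rightarrow> real ^ 'n \<Rightarrow> real"
  assumes m_pos: "1 \<le> m"
    and X_sub: "\<And>i. i \<in> {1..m} \<Longrightarrow> X i \<subseteq> block_space blk i"
    and u_tight: "\<And>i v. i \<in> {1..m} \<Longrightarrow> v \<in> block_prod blk m X \<Longrightarrow> u i (block blk i v) v = f v"
    and u_upper: "\<And>i v w. i \<in> {1..m} \<Longrightarrow> v \<in> block_prod blk m X \<Longrightarrow> w \<in> X i \<Longrightarrow>
                    f (block_upd blk i v w) \<le> u i w v"
    and u_cont: "\<And>i. i \<in> {1..m} \<Longrightarrow>
                    continuous_on (X i \<times> block_prod blk m X) (\<lambda>(w, v). u i w v)"
    and f_bdd: "bdd_below (f ` block_prod blk m X)"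
begin

abbreviation feasible :: "(real ^ 'n) set" where
  "feasible \<equiv> block_prod blk m X"

definition gap :: "nat \<Rightarrow> real ^ 'n \<Rightarrow> real" where
  "gap i v = f v - (INF w\<in>X i. u i w v)"

definition f_low :: real where
  "f_low = (INF v\<in>feasible. f v)"

lemma f_low_le: "v \<in> feasible \<Longrightarrow> f_low \<le> f v"
  unfolding f_low_def using f_bdd by (intro cINF_lower) auto

lemma block_in_X: "i \<in> {1..m} \<Longrightarrow> v \<in> feasible \<Longrightarrow> block blk i v \<in> X i"
  by (auto simp: block_prod_def)

lemma block_upd_feasible:
  assumes "i \<in> {1..m}" "v \<in> feasible" "w \<in> X i"
  shows "block_upd blk i v w \<in> feasible"
  unfolding block_prod_def
proof clarify
  fix j assume j: "j \<in> {1..m}"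
  show "block blk j (block_upd blk i v w) \<in> X j"
  proof (cases "j = i")
    case True
    then show ?thesis
      using assms X_sub[of i] by (auto simp: block_block_upd_same)
  next
    case False
    then show ?thesis
      using block_in_X[OF j assms(2)] by (simp add: block_block_upd_other)
  qed
qed

text \<open>The upper-bound property turns boundedness of \<open>f\<close> into boundedness of the surrogates.\<close>

lemma surrogate_bdd_below:
  assumes "i \<in> {1..m}" "v \<in> feasible"
  shows "bdd_below ((\<lambda>w. u i w v) ` X i)"
proof (rule bdd_belowI2)
  fix w assume "w \<in> X i"
  then show "f_low \<le> u i w v"
    using f_low_le[OF block_upd_feasible] u_upper assms by (meson order_trans)
qed

lemma surrogate_ge:
  assumes "i \<in> {1..m}" "v \<in> feasible" "w \<in> X i"
  shows "f v - gap i v \<le> u i w v"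
  unfolding gap_def using cINF_lower[OF surrogate_bdd_below[OF assms(1,2)] assms(3)] by simp

lemma gap_nonneg:
  assumes "i \<in> {1..m}" "v \<in> feasible"
  shows "0 \<le> gap i v"
  using surrogate_ge[OF assms block_in_X[OF assms]] u_tight[OF assms] by simp

lemma block_update_descent:
  assumes i: "i \<in> {1..m}" and v: "v \<in> feasible"
    and min: "is_arg_min (\<lambda>w. u i w v) (\<lambda>w. w \<in> X i) z"
  shows "block_upd blk i v z \<in> feasible"
    and "f (block_upd blk i v z) \<le> f v - gap i v"
proof -
  have z: "z \<in> X i" and le: "\<And>w. w \<in> X i \<Longrightarrow> u i z v \<le> u i w v"
    using min by (auto simp: is_arg_min_linorder)
  show "block_upd blk i v z \<in> feasible"
    by (rule block_upd_feasible[OF i v z])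
  have "u i z v \<le> (INF w\<in>X i. u i w v)"
    using z le by (intro cINF_greatest) auto
  then show "f (block_upd blk i v z) \<le> f v - gap i v"
    using u_upper[OF i v z] by (simp add: gap_def)
qed

text \<open>
  Only the first block of a sweep is known to be updated at the vector with which the sweep starts;
  the later updates contribute no more than monotonicity.
\<close>

lemma sweep_descent:
  assumes perm: "s \<in> permutations_of_set {1..m}" and start: "v 0 \<in> feasible"
    and upd: "\<And>j. j < m \<Longrightarrow> \<exists>z. is_arg_min (\<lambda>z. u (s ! j) z (v j)) (\<lambda>z. z \<in> X (s ! j)) z \<and>
                v (Suc j) = block_upd blk (s ! j) (v j) z"
  shows "v m \<in> feasible" and "f (v m) \<le> f (v 0) - gap (s ! 0) (v 0)"
proof -
  have len: "length s = m" and set: "set s = {1..m}"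
    using perm by (auto simp: permutations_of_set_def distinct_card[symmetric])
  have s: "s ! j \<in> {1..m}" if "j < m" for j
    using that len set nth_mem by blast
  have step: "v (Suc j) \<in> feasible" "f (v (Suc j)) \<le> f (v j) - gap (s ! j) (v j)"
    if "j < m" "v j \<in> feasible" for j
    using upd[OF that(1)] block_update_descent[OF s[OF that(1)] that(2)] by auto
  have "v (Suc j) \<in> feasible \<and> f (v (Suc j)) \<le> f (v 0) - gap (s ! 0) (v 0)" if "j < m" for j
    using that
  proof (induction j)
    case 0
    then show ?case
      using step[of 0] start by simp
  next
    case (Suc j)
    then show ?case
      using step[of "Suc j"] gap_nonneg[of "s ! Suc j" "v (Suc j)"] s[of "Suc j"] by force
  qed
  from this[of "m - 1"] show "v m \<in> feasible" "f (v m) \<le> f (v 0) - gap (s ! 0) (v 0)"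
    using m_pos by auto
qed

lemma surrogate_tendsto:
  assumes i: "i \<in> {1..m}" and w: "\<And>n. w n \<in> X i" "w \<longlonglongrightarrow> w'" "w' \<in> X i"
    and v: "\<And>n. v n \<in> feasible" "v \<longlonglongrightarrow> v'" "v' \<in> feasible"
  shows "(\<lambda>n. u i (w n) (v n)) \<longlonglongrightarrow> u i w' v'"
  using continuous_on_tendsto_compose[OF u_cont[OF i], of "\<lambda>n. (w n, v n)" "(w', v')" sequentially] w v
  by (auto intro: tendsto_Pair)

text \<open>
  Continuity of \<open>f\<close> is not assumed, but follows from continuity of a surrogate on the diagonal
  \<open>w = block i v\<close>, where both agree.  So \<open>f (v n) - gap i (v n) \<le> u i w (v n)\<close> passes to the limit.
\<close>

lemma block_minimal_of_gap_vanishes: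
  assumes i: "i \<in> {1..m}" and v: "\<And>n. v n \<in> feasible" "v \<longlonglongrightarrow> z" and z: "z \<in> feasible"
    and gap: "(\<lambda>n. gap i (v n)) \<longlonglongrightarrow> 0" and w: "w \<in> X i"
  shows "u i (block blk i z) z \<le> u i w z"
proof -
  have "(\<lambda>n. block blk i (v n)) \<longlonglongrightarrow> block blk i z"
    using continuous_on_tendsto_compose[OF continuous_on_block[of UNIV] v(2)] by simp
  from surrogate_tendsto[OF i _ this _ v z]
  have "(\<lambda>n. u i (block blk i (v n)) (v n)) \<longlonglongrightarrow> u i (block blk i z) z"
    using block_in_X[OF i] v(1) z by blast
  then have "(\<lambda>n. f (v n)) \<longlonglongrightarrow> u i (block blk i z) z"
    using u_tight[OF i] v(1) by simp
  from tendsto_diff[OF this gap]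
  have "(\<lambda>n. f (v n) - gap i (v n)) \<longlonglongrightarrow> u i (block blk i z) z"
    by simp
  moreover have "(\<lambda>n. u i w (v n)) \<longlonglongrightarrow> u i w z"
    using surrogate_tendsto[OF i _ _ w v z, of "\<lambda>_. w"] w by simp
  ultimately show ?thesis
    using surrogate_ge[OF i v(1) w] by (intro LIMSEQ_le) auto
qed

lemma stationary_of_gaps_vanish:
  assumes X_closed: "\<And>i. i \<in> {1..m} \<Longrightarrow> closed (X i)"
    and X_convex: "\<And>i. i \<in> {1..m} \<Longrightarrow> convex (X i)"
    and u_deriv: "\<And>i v d. i \<in> {1..m} \<Longrightarrow> v \<in> feasible \<Longrightarrow> d \<in> block_space blk i \<Longrightarrow>
                    block blk i v + d \<in> X i \<Longrightarrow>
                    dir_deriv (\<lambda>w. u i w v) (block blk i v) d = dir_deriv f v d"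
    and f_regular: "regular_on blk m feasible f"
    and v: "\<And>n. v n \<in> feasible" "v \<longlonglongrightarrow> z"
    and gap: "\<And>i. i \<in> {1..m} \<Longrightarrow> (\<lambda>n. gap i (v n)) \<longlonglongrightarrow> 0"
  shows "stationary_point feasible f z"
proof -
  have z: "z \<in> feasible"
    by (rule closed_sequentially[OF closed_block_prod v]) (rule X_closed)
  have "0 \<le> dir_deriv f z d" if d: "z + d \<in> feasible" for d
  proof -
    have "0 \<le> dir_deriv f z (block blk i d)" if i: "i \<in> {1..m}" for i
    proof -
      have mem: "block blk i z + block blk i d \<in> X i"
        using block_in_X[OF i d] by (simp add: block_add)
      have "0 \<le> dir_deriv (\<lambda>w. u i w z) (block blk i z) (block blk i d)"
        using block_minimal_of_gap_vanishes[OF i v z gap[OF i]]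
        by (intro dir_deriv_nonneg_if_min[OF X_convex[OF i] block_in_X[OF i z] mem])
      then show ?thesis
        using u_deriv[OF i z block_in_block_space mem] by simp
    qed
    then show ?thesis
      using f_regular z d by (auto simp: regular_on_def regular_at_def)
  qed
  with z show ?thesis
    by (simp add: stationary_point_def)
qed

section \<open>Almost sure decay of the gaps\<close>

lemma pr_bsumD:
  assumes "pr_bsum M blk m X u x0 \<sigma> y x" and "\<omega> \<in> space M"
  shows "x 0 \<omega> = x0" and "y k 0 \<omega> = x k \<omega>" and "x (Suc k) \<omega> = y k m \<omega>"
    and "j < m \<Longrightarrow> \<exists>z. is_arg_min (\<lambda>z. u (\<sigma> k \<omega> ! j) z (y k j \<omega>)) (\<lambda>z. z \<in> X (\<sigma> k \<omega> ! j)) z \<and>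
                y k (Suc j) \<omega> = block_upd blk (\<sigma> k \<omega> ! j) (y k j \<omega>) z"
  using assms unfolding pr_bsum_def by blast+

lemma pr_bsum_permutation:
  assumes alg: "pr_bsum M blk m X u x0 \<sigma> y x" and "\<omega> \<in> space M"
  shows "\<sigma> k \<omega> \<in> permutations_of_set {1..m}"
proof -
  have "prob_space M"
    "prob_space.indep_vars M (\<lambda>_. count_space (permutations_of_set {1..m})) \<sigma> UNIV"
    using alg by (auto simp: pr_bsum_def iid_uniform_permutations_def)
  then have "\<sigma> k \<in> measurable M (count_space (permutations_of_set {1..m}))"
    by (simp add: prob_space.indep_vars_def)
  from measurable_space[OF this assms(2)] show ?thesis
    by simp
qed

lemma pr_bsum_sweep:
  assumes alg: "pr_bsum M blk m X u x0 \<sigma> y x" and x0: "x0 \<in> feasible"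
    and \<omega>: "\<omega> \<in> space M"
  shows "x k \<omega> \<in> feasible" and "f (x (Suc k) \<omega>) \<le> f (x k \<omega>) - gap (\<sigma> k \<omega> ! 0) (x k \<omega>)"
proof -
  note run = pr_bsumD[OF alg \<omega>]
  have sweep: "x (Suc k) \<omega> \<in> feasible"
    "f (x (Suc k) \<omega>) \<le> f (x k \<omega>) - gap (\<sigma> k \<omega> ! 0) (x k \<omega>)" if "x k \<omega> \<in> feasible" for k
    using sweep_descent[where s = "\<sigma> k \<omega>" and v = "\<lambda>j. y k j \<omega>", OF pr_bsum_permutation[OF alg \<omega>]] run(4) that
    by (simp_all add: run(2,3))
  show feas: "x k \<omega> \<in> feasible" for k
    by (induction k) (use x0 run(1) sweep(1) in auto)
  then show "f (x (Suc k) \<omega>) \<le> f (x k \<omega>) - gap (\<sigma> k \<omega> ! 0) (x k \<omega>)"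
    by (rule sweep(2))
qed

lemma pr_bsum_iterate_past:
  assumes alg: "pr_bsum M blk m X u x0 \<sigma> y x"
    and \<omega>: "\<omega> \<in> space M" "\<omega>' \<in> space M" and eq: "\<And>l. l < k \<Longrightarrow> \<sigma> l \<omega> = \<sigma> l \<omega>'"
  shows "x k \<omega> = x k \<omega>'"
proof (cases k)
  case 0
  then show ?thesis
    using pr_bsumD(1)[OF alg] assms by metis
next
  case (Suc n)
  have "\<forall>j\<le>m. y n j \<omega> = y n j \<omega>'"
  proof -
    have "\<forall>l\<le>n. \<sigma> l \<omega> = \<sigma> l \<omega>'"
      using eq Suc by simp
    then show ?thesis
      using alg \<omega> unfolding pr_bsum_def by blast
  qed
  then show ?thesis
    using pr_bsumD(3)[OF alg] \<omega> Suc by simp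
qed

lemma first_block_prob_pos:
  assumes "i \<in> {1..m}"
  shows "0 < measure (uniform_count_measure (permutations_of_set {1..m}))
               {s \<in> permutations_of_set {1..m}. s ! 0 = i}"
proof -
  obtain s where s: "set s = {1..m} - {i}" "distinct s"
    using finite_distinct_list[of "{1..m} - {i}"] by auto
  have "insert i (set s) = {1..m}"
    using s(1) assms by blast
  then have "i # s \<in> permutations_of_set {1..m}"
    using s by (intro permutations_of_setI) auto
  then have mem: "i # s \<in> {s \<in> permutations_of_set {1..m}. s ! 0 = i}"
    by simp
  have fin: "finite (permutations_of_set {1..m})"
    by simp
  have "0 < card {s \<in> permutations_of_set {1..m}. s ! 0 = i}"
    using mem fin by (subst card_gt_0_iff) fastforce
  moreover have "0 < card (permutations_of_set {1..m})"
    using mem fin by (subst card_gt_0_iff) fastforce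
  ultimately show ?thesis
    using fin by (subst measure_uniform_count_measure) auto
qed

text \<open>
  The gap in front of sweep \<open>k\<close> is sure to be realized as a decrease of \<open>f\<close> only when block \<open>i\<close>
  comes first, but by independence this costs just a constant factor in expectation, so the sums telescope.
\<close>

lemma sum_expected_gap_le:
  fixes M :: "'w measure"
  assumes alg: "pr_bsum M blk m X u x0 \<sigma> y x" and x0: "x0 \<in> feasible" and i: "i \<in> {1..m}"
  defines "p \<equiv> measure (uniform_count_measure (permutations_of_set {1..m}))
               {s \<in> permutations_of_set {1..m}. s ! 0 = i}"
  shows "integrable M (\<lambda>\<omega>. gap i (x k \<omega>))"
    and "(\<Sum>k<n. \<integral>\<omega>. gap i (x k \<omega>) \<partial>M) \<le> (f x0 - f_low) / p"
proof -
  define S where "S = permutations_of_set {1..m}"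
  define A where "A = {s \<in> S. s ! 0 = i}"
  have iid: "iid_uniform_permutations M m \<sigma>"
    using alg by (simp add: pr_bsum_def)
  interpret prob_space M
    using iid by (simp add: iid_uniform_permutations_def)
  have ind: "indep_vars (\<lambda>_. count_space S) \<sigma> UNIV"
    and unif: "\<And>k. distr M (count_space S) (\<sigma> k) = uniform_count_measure S"
    using iid by (auto simp: iid_uniform_permutations_def S_def)
  have fin: "finite S" and AS: "A \<subseteq> S"
    by (auto simp: S_def A_def)
  have meas: "\<sigma> l \<in> measurable M (count_space S)" for l
    using ind by (auto simp: indep_vars_def)
  note sweep = pr_bsum_sweep[OF alg x0]
  have int: "integrable M (\<lambda>\<omega>. g (x k \<omega>))" for g :: "real ^ 'n \<Rightarrow> real" and k
    by (rule finite_history_factor[where \<sigma> = \<sigma> and k = k and U = "\<lambda>\<omega>. g (x k \<omega>)", OF fin meas])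
      (auto intro: arg_cong[where f = g] pr_bsum_iterate_past[OF alg])
  show "integrable M (\<lambda>\<omega>. gap i (x k \<omega>))"
    by (rule int)
  define E where "E k = expectation (\<lambda>\<omega>. f (x k \<omega>))" for k
  have decrease: "p * expectation (\<lambda>\<omega>. gap i (x k \<omega>)) \<le> E k - E (Suc k)" for k
  proof -
    have past: "gap i (x k \<omega>) = gap i (x k \<omega>')"
      if "\<omega> \<in> space M" "\<omega>' \<in> space M" "\<And>l. l < k \<Longrightarrow> \<sigma> l \<omega> = \<sigma> l \<omega>'" for \<omega> \<omega>'
      using pr_bsum_iterate_past[OF alg that] by simp
    have ind_int: "integrable M (\<lambda>\<omega>. indicator A (\<sigma> k \<omega>) * gap i (x k \<omega>))"
      by (rule expectation_indicator_mult_past(1)[OF ind fin AS]) (rule past)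
    have "expectation (\<lambda>\<omega>. indicator A (\<sigma> k \<omega>) * gap i (x k \<omega>))
            = measure (distr M (count_space S) (\<sigma> k)) A * expectation (\<lambda>\<omega>. gap i (x k \<omega>))"
      by (rule expectation_indicator_mult_past(2)[OF ind fin AS]) (rule past)
    then have "p * expectation (\<lambda>\<omega>. gap i (x k \<omega>))
            = expectation (\<lambda>\<omega>. indicator A (\<sigma> k \<omega>) * gap i (x k \<omega>))"
      unfolding unif unfolding p_def A_def S_def by (rule sym)
    also have "\<dots> \<le> expectation (\<lambda>\<omega>. f (x k \<omega>) - f (x (Suc k) \<omega>))"
    proof (rule integral_mono[OF ind_int])
      show "integrable M (\<lambda>\<omega>. f (x k \<omega>) - f (x (Suc k) \<omega>))"
        by (intro Bochner_Integration.integrable_diff int)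
      fix \<omega> assume \<omega>: "\<omega> \<in> space M"
      have set: "set (\<sigma> k \<omega>) = {1..m}"
        by (rule permutations_of_setD(1)[OF pr_bsum_permutation[OF alg \<omega>]])
      have "\<sigma> k \<omega> \<noteq> []"
        using set m_pos by force
      then have "\<sigma> k \<omega> ! 0 \<in> {1..m}"
        unfolding set[symmetric] by (intro nth_mem) simp
      then have "0 \<le> gap (\<sigma> k \<omega> ! 0) (x k \<omega>)"
        by (rule gap_nonneg) (rule sweep(1)[OF \<omega>])
      then show "indicator A (\<sigma> k \<omega>) * gap i (x k \<omega>) \<le> f (x k \<omega>) - f (x (Suc k) \<omega>)"
        using sweep(2)[OF \<omega>, of k] by (cases "\<sigma> k \<omega> \<in> A") (simp_all add: A_def)
    qed
    also have "\<dots> = E k - E (Suc k)"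
      unfolding E_def by (intro Bochner_Integration.integral_diff int)
    finally show ?thesis .
  qed
  have p: "0 < p"
    unfolding p_def by (rule first_block_prob_pos[OF i])
  have "p * (\<Sum>k<n. expectation (\<lambda>\<omega>. gap i (x k \<omega>))) \<le> (\<Sum>k<n. E k - E (Suc k))"
    unfolding sum_distrib_left by (intro sum_mono decrease)
  also have "\<dots> = E 0 - E n"
    by (rule sum_lessThan_telescope')
  also have "E 0 = f x0"
  proof -
    have "E 0 = expectation (\<lambda>_. f x0)"
      unfolding E_def using pr_bsumD(1)[OF alg] by (intro Bochner_Integration.integral_cong) auto
    then show ?thesis
      by (simp add: prob_space)
  qed
  finally have "p * (\<Sum>k<n. expectation (\<lambda>\<omega>. gap i (x k \<omega>))) \<le> f x0 - E n" .
  moreover have "f_low \<le> E n"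
    unfolding E_def using int f_low_le[OF sweep(1)] by (intro integral_ge_const) auto
  ultimately have "p * (\<Sum>k<n. expectation (\<lambda>\<omega>. gap i (x k \<omega>))) \<le> f x0 - f_low"
    by linarith
  then show "(\<Sum>k<n. \<integral>\<omega>. gap i (x k \<omega>) \<partial>M) \<le> (f x0 - f_low) / p"
    using p by (simp add: field_simps)
qed

end

theorem mainTheorem1:
  fixes blk :: "'n::finite \<Rightarrow> nat" and m :: nat
    and X :: "nat \<Rightarrow> (real ^ 'n) set"
    and f :: "real ^ 'n \<Rightarrow> real"
    and u :: "nat \<Rightarrow> real ^ 'n \<Rightarrow> real ^ 'n \<Rightarrow> real"
    and M :: "'w measure"
    and x0 :: "real ^ 'n"
    and \<sigma> :: "nat \<Rightarrow> 'w \<Rightarrow> nat list"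
    and y :: "nat \<Rightarrow> nat \<Rightarrow> 'w \<Rightarrow> real ^ 'n"
    and x :: "nat \<Rightarrow> 'w \<Rightarrow> real ^ 'n"
  assumes blocks: "\<And>j. blk j \<in> {1..m}"
    and X_sub: "\<And>i. i \<in> {1..m} \<Longrightarrow> X i \<subseteq> block_space blk i"
    and X_closed: "\<And>i. i \<in> {1..m} \<Longrightarrow> closed (X i)"
    and X_convex: "\<And>i. i \<in> {1..m} \<Longrightarrow> convex (X i)"
    and u_tight: "\<And>i v. i \<in> {1..m} \<Longrightarrow> v \<in> block_prod blk m X \<Longrightarrow> u i (block blk i v) v = f v"
    and u_upper: "\<And>i v w. i \<in> {1..m} \<Longrightarrow> v \<in> block_prod blk m X \<Longrightarrow> w \<in> X i \<Longrightarrow>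
                    f (block_upd blk i v w) \<le> u i w v"
    and u_deriv: "\<And>i v d. i \<in> {1..m} \<Longrightarrow> v \<in> block_prod blk m X \<Longrightarrow> d \<in> block_space blk i \<Longrightarrow>
                    block blk i v + d \<in> X i \<Longrightarrow>
                    dir_deriv (\<lambda>w. u i w v) (block blk i v) d = dir_deriv f v d"
    and u_cont: "\<And>i. i \<in> {1..m} \<Longrightarrow>
                    continuous_on (X i \<times> block_prod blk m X) (\<lambda>(w, v). u i w v)"
    and f_regular: "regular_on blk m (block_prod blk m X) f"
    and f_bdd: "bdd_below (f ` block_prod blk m X)"
    and x0: "x0 \<in> block_prod blk m X"
    and alg: "pr_bsum M blk m X u x0 \<sigma> y x"
  shows "AE \<omega> in M. \<forall>z. seq_limit_point (\<lambda>k. x k \<omega>) z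
                      \<longrightarrow> stationary_point (block_prod blk m X) f z"
proof -
  have m_pos: "1 \<le> m"
    using blocks by (meson atLeastAtMost_iff order_trans)
  interpret block_majorization blk m X f u
    using m_pos X_sub u_tight u_upper u_cont f_bdd by unfold_locales
  note feas = pr_bsum_sweep(1)[OF alg x0]
  have "AE \<omega> in M. (\<lambda>k. gap i (x k \<omega>)) \<longlonglongrightarrow> 0" if i: "i \<in> {1..m}" for i
    using sum_expected_gap_le[OF alg x0 i] gap_nonneg[OF i feas]
    by (intro AE_LIMSEQ_zero_of_expectation_sums) auto
  then have "AE \<omega> in M. \<forall>i\<in>{1..m}. (\<lambda>k. gap i (x k \<omega>)) \<longlonglongrightarrow> 0"
    by (intro AE_finite_allI) auto
  with AE_space show ?thesis
  proof eventually_elim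
    case (elim \<omega>)
    show ?case
    proof (intro allI impI)
      fix z assume "seq_limit_point (\<lambda>k. x k \<omega>) z"
      then obtain r where r: "strict_mono r" "((\<lambda>k. x k \<omega>) \<circ> r) \<longlonglongrightarrow> z"
        by (auto simp: seq_limit_point_def)
      have "(\<lambda>n. gap i (x (r n) \<omega>)) \<longlonglongrightarrow> 0" if "i \<in> {1..m}" for i
        using LIMSEQ_subseq_LIMSEQ[OF bspec[OF elim(2) that] r(1)] by (simp add: comp_def)
      moreover have "(\<lambda>n. x (r n) \<omega>) \<longlonglongrightarrow> z"
        using r(2) by (simp add: comp_def)
      ultimately show "stationary_point (block_prod blk m X) f z"
        using feas[OF elim(1)]
        by (intro stationary_of_gaps_vanish[OF X_closed X_convex u_deriv f_regular,
              where v = "\<lambda>n. x (r n) \<omega>"]) auto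
    qed
  qed
qed

end
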